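(* Let $P(q)=(q^4;q^4)_\infty\, S(q)$, where $S(q)=\sum_{m\ge 0}\frac{(q;q^2)_m^2\,q^{2m}}{(-q^2;q^2)_m}$, regarded as a formal power series in $q$. Then for every integer $n\ge 0$ with $$n\equiv 1,4,5,6,9,12,13 \pmod{16}$$ we have $[q^n]P(q)=0$.
   Context: Notation: $(a;q)_0:=1$, $(a;q)_n:=\prod_{j=0}^{n-1}(1-aq^j)$, $(a;q)_\infty:=\prod_{j=0}^{\infty}(1-aq^j)$ for $|q|<1$ (or as formal power series in $q$). Thus $(q;q^2)_m=\prod_{j=0}^{m-1}(1-q^{2j+1})$, $(-q^2;q^2)_m=\prod_{j=1}^{m}(1+q^{2j})$ and $(q^4;q^4)_\infty=\prod_{j\ge 1}(1-q^{4j})$. $[q^n]P(q)$ denotes the coefficient of $q^n$ in $P(q)$. *)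

theory Defs
  imports
    "HOL-Analysis.Infinite_Products"
    "HOL-Computational_Algebra.Formal_Power_Series"
begin

definition qpoch :: "'a::comm_ring_1 \<Rightarrow> 'a \<Rightarrow> nat \<Rightarrow> 'a" where
  "qpoch a q n = (\<Prod>j<n. 1 - a * q ^ j)"

definition qpoch_inf :: "'a::{t2_space, comm_ring_1} \<Rightarrow> 'a \<Rightarrow> 'a" where
  "qpoch_inf a q = (\<Prod>j. 1 - a * q ^ j)"

text \<open>
  The variable \<open>q\<close> is \<^const>\<open>fps_X\<close>. Infinite sums and products are limits in the
  \<open>q\<close>-adic metric on formal power series. The coefficients are taken in \<^typ>\<open>rat\<close> because
  division of power series requires a coefficient type with an inverse; every denominator
  has constant coefficient 1, so \<open>/\<close> is multiplication by the inverse series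
  (\<open>S_term_eq\<close> below).
\<close>

definition S_term :: "nat \<Rightarrow> rat fps" where
  "S_term m =
     (qpoch fps_X (fps_X ^ 2) m) ^ 2 * fps_X ^ (2 * m) / qpoch (- (fps_X ^ 2)) (fps_X ^ 2) m"

definition S_series :: "rat fps" where
  "S_series = (\<Sum>m. S_term m)"

definition P_series :: "rat fps" where
  "P_series = qpoch_inf (fps_X ^ 4) (fps_X ^ 4) * S_series"

text \<open>
  \<^const>\<open>suminf\<close> and \<^const>\<open>prodinf\<close> are meaningful only for convergent arguments; the
  following facts establish convergence in both uses above.
\<close>

lemma qpoch_fps_nth_0:
  fixes a q :: "'a::comm_ring_1 fps"
  assumes "fps_nth a 0 = 0"
  shows "fps_nth (qpoch a q n) 0 = 1"
  by (induction n) (simp_all add: qpoch_def assms)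

lemma qpoch_inf_fps_has_prod:
  fixes a q :: "'a::comm_ring_1 fps"
  assumes "fps_nth a 0 = 0" and "fps_nth q 0 = 0"
  shows "(\<lambda>j. 1 - a * q ^ j) has_prod qpoch_inf a q"
proof -
  define Q where "Q = qpoch a q"
  define P where "P = Abs_fps (\<lambda>n. fps_nth (Q (Suc n)) n)"
  have step: "fps_nth (Q (Suc N)) n = fps_nth (Q N) n" if "n < N" for n N
  proof -
    have "fps_nth (Q N * a * q ^ N) n = (\<Sum>i=0..n. fps_nth (Q N * a) i * fps_nth (q ^ N) (n - i))"
      by (simp add: fps_mult_nth)
    also have "\<dots> = 0"
      using startsby_zero_power_prefix[of q N] assms(2) that
      by (intro sum.neutral) auto
    finally show ?thesis
      by (simp add: Q_def qpoch_def algebra_simps)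
  qed
  have const: "fps_nth (Q N) n = fps_nth (Q (Suc n)) n" if "Suc n \<le> N" for n N
    using that by (induction N rule: dec_induct) (simp_all add: step)
  have "(\<lambda>n. \<Prod>i\<le>n. 1 - a * q ^ (i + 0)) = (\<lambda>n. Q (Suc n))"
    by (simp add: Q_def qpoch_def lessThan_Suc_atMost)
  moreover have "(\<lambda>n. Q (Suc n)) \<longlonglongrightarrow> P"
  proof (rule tendsto_fpsI)
    fix n
    show "eventually (\<lambda>N. fps_nth (Q (Suc N)) n = fps_nth P n) sequentially"
      using eventually_ge_at_top[of n]
    proof eventually_elim
      case (elim N)
      have "fps_nth (Q (Suc N)) n = fps_nth (Q (Suc n)) n"
        by (rule const) (use elim in simp)
      thus ?case
        unfolding P_def by simp
    qed
  qed
  moreover have "fps_nth P 0 = 1"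
    by (simp add: P_def Q_def qpoch_fps_nth_0 assms)
  hence "P \<noteq> 0"
    by auto
  ultimately have P: "(\<lambda>j. 1 - a * q ^ j) has_prod P"
    by (simp add: has_prod_def raw_has_prod_def)
  moreover have "R = P" if R: "(\<lambda>j. 1 - a * q ^ j) has_prod R" for R
  proof -
    have nz: "1 - a * q ^ i \<noteq> 0" for i
    proof
      assume "1 - a * q ^ i = 0"
      hence "fps_nth (1 - a * q ^ i) 0 = 0" by simp
      thus False by (simp add: assms)
    qed
    with R P have "raw_has_prod (\<lambda>j. 1 - a * q ^ j) 0 R" "raw_has_prod (\<lambda>j. 1 - a * q ^ j) 0 P"
      by (auto simp: has_prod_def)
    thus ?thesis
      unfolding raw_has_prod_def by (blast intro: LIMSEQ_unique)
  qed
  ultimately show ?thesis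
    unfolding qpoch_inf_def prodinf_def by (rule theI)
qed

lemma S_term_eq:
  "S_term m = (qpoch fps_X (fps_X ^ 2) m) ^ 2 * fps_X ^ (2 * m) *
     inverse (qpoch (- (fps_X ^ 2)) (fps_X ^ 2) m)"
  unfolding S_term_def by (rule fps_divide_unit) (simp add: qpoch_fps_nth_0)

lemma S_term_nth_eq_0: "n < 2 * m \<Longrightarrow> fps_nth (S_term m) n = 0"
proof -
  assume "n < 2 * m"
  moreover have "S_term m = fps_X ^ (2 * m) * ((qpoch fps_X (fps_X ^ 2) m) ^ 2 *
      inverse (qpoch (- (fps_X ^ 2)) (fps_X ^ 2) m))"
    by (simp add: S_term_eq mult_ac)
  ultimately show ?thesis
    by (simp only: fps_X_power_mult_nth) simp
qed

lemma S_term_sums: "S_term sums S_series"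
proof -
  define T where "T = Abs_fps (\<lambda>n. (\<Sum>m<Suc n. fps_nth (S_term m) n))"
  have "(\<lambda>N. \<Sum>m<N. S_term m) \<longlonglongrightarrow> T"
  proof (rule tendsto_fpsI)
    fix n
    show "eventually (\<lambda>N. fps_nth (\<Sum>m<N. S_term m) n = fps_nth T n) sequentially"
      using eventually_ge_at_top[of "Suc n"]
    proof eventually_elim
      case (elim N)
      have "(\<Sum>m<N. fps_nth (S_term m) n) = (\<Sum>m<Suc n. fps_nth (S_term m) n)"
        using elim by (intro sum.mono_neutral_right) (auto intro!: S_term_nth_eq_0)
      thus ?case
        by (simp add: T_def fps_sum_nth)
    qed
  qed
  hence "S_term sums T"
    by (simp add: sums_def)
  thus ?thesis
    unfolding S_series_def using sums_unique by blast
qed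

end

theory Submission
  imports Defs
begin

text \<open>
  The vanishing comes from a quadratic form: every exponent \<open>n\<close> that occurs in \<open>P(q)\<close> satisfies
  \<open>6n + 4 = x\<^sup>2 - 3j\<^sup>2\<close> for some integers \<open>x\<close> and \<open>j\<close>. Modulo 32 the right-hand side misses
  the values that the seven residue classes would give.

  To see the quadratic form, put \<open>p = q\<^sup>2\<close>. The finite Jacobi triple product writes
  \<open>(q;q\<^sup>2)\<^sub>m\<^sup>2\<close> as the sum of \<open>(-1)\<^sup>j q\<^bsup>j\<^sup>2\<^esup> [2m, m+j]\<^sub>p\<close> over \<open>\<bar>j\<bar> \<le> m\<close>, so that after
  exchanging the order of summation
  \[ P(q) = \sum_{j} (-1)^j q^{j^2} (p^2;p^2)_\infty F_j, \qquad
     F_j = \sum_{m \ge 0} \frac{p^m [2m, m+j]_p}{(-p;p)_m}. \]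
  These series satisfy
  \[ F_j + p^{3j+3} F_{j+2} = \frac{p^j (1 + p^{j+1})}{(p^2;p^2)_\infty}, \]
  because the summand of the left-hand side telescopes in \<open>m\<close> (\<open>telescoping_certificate\<close>) and
  \<open>[2M, M+j+1]\<^sub>p / (-p;p)\<^sub>M\<close> tends to \<open>1 / (p\<^sup>2;p\<^sup>2)\<^sub>\<infinity>\<close>. For
  \<open>H\<^sub>j = q\<^bsup>j\<^sup>2\<^esup> (p\<^sup>2;p\<^sup>2)\<^sub>\<infinity> F\<^sub>j\<close> this reads
  \[ H_j = q^{j^2+2j} (1 + q^{2j+2}) - q^{2j+2} H_{j+2}. \]
  The two exponents of the first summand give \<open>6n + 4 + 3j\<^sup>2 = (3j + 2)\<^sup>2\<close> and \<open>(3j + 4)\<^sup>2\<close>, and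
  the shift by \<open>2j + 2\<close> turns \<open>6n + 4 + 3(j+2)\<^sup>2\<close> into \<open>6n + 4 + 3j\<^sup>2\<close>. Hence induction on the
  exponent shows that \<open>6n + 4 + 3j\<^sup>2\<close> is a square for every exponent \<open>n\<close> of \<open>H\<^sub>j\<close>
  (\<open>theta_part_support\<close>).

  The sums over \<open>m\<close> are truncated at \<open>M\<close>, which keeps the recurrence an exact identity; each
  coefficient is then read off for all large \<open>M\<close>.
\<close>

section \<open>Gaussian binomial coefficients\<close>

text \<open>
  The Pascal recursion avoids division, so the coefficients make sense over every commutative ring
  and for roots of unity, and they vanish for \<open>k > n\<close>.
\<close>

fun gauss_binomial :: "'a::comm_ring_1 \<Rightarrow> nat \<Rightarrow> nat \<Rightarrow> 'a" where
  "gauss_binomial q n 0 = 1"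
| "gauss_binomial q 0 (Suc k) = 0"
| "gauss_binomial q (Suc n) (Suc k) = gauss_binomial q n k + q ^ Suc k * gauss_binomial q n (Suc k)"

lemma gauss_binomial_eq_0: "n < k \<Longrightarrow> gauss_binomial q n k = 0"
proof (induction n arbitrary: k)
  case 0
  thus ?case by (cases k) auto
next
  case (Suc n)
  thus ?case by (cases k) auto
qed

text \<open>
  The two ratio rules \<open>gauss_binomial_Suc_right\<close> and \<open>gauss_binomial_absorb\<close> support each other in
  the induction on \<open>n\<close>: the first at level \<open>n\<close> gives the second at level \<open>n\<close>, which gives the
  first at level \<open>n + 1\<close>.
\<close>

lemma gauss_binomial_absorb_aux:
  assumes "(1 - q ^ Suc k) * gauss_binomial q n (Suc k) = (1 - q ^ (n - k)) * gauss_binomial q n k"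
    and "k \<le> n"
  shows "(1 - q ^ Suc k) * gauss_binomial q (Suc n) (Suc k) = (1 - q ^ Suc n) * gauss_binomial q n k"
proof -
  have "Suc n = Suc k + (n - k)"
    using assms(2) by simp
  hence pow: "q ^ Suc n = q ^ Suc k * q ^ (n - k)"
    by (metis power_add)
  have "(1 - q ^ Suc k) * gauss_binomial q (Suc n) (Suc k) =
      (1 - q ^ Suc k) * gauss_binomial q n k +
      q ^ Suc k * ((1 - q ^ Suc k) * gauss_binomial q n (Suc k))"
    by (simp only: gauss_binomial.simps) (simp add: algebra_simps)
  also have "\<dots> = (1 - q ^ Suc n) * gauss_binomial q n k"
    unfolding assms(1) pow by (simp only: left_diff_distrib right_diff_distrib mult_1_left mult.assoc) simp
  finally show ?thesis .
qed

lemma gauss_binomial_Suc_right: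
  "k \<le> n \<Longrightarrow>
     (1 - q ^ Suc k) * gauss_binomial q n (Suc k) = (1 - q ^ (n - k)) * gauss_binomial q n k"
proof (induction n arbitrary: k)
  case 0
  thus ?case by simp
next
  case (Suc n)
  show ?case
  proof (cases k)
    case 0
    show ?thesis
      using gauss_binomial_absorb_aux[OF Suc.IH[of 0]] 0 by simp
  next
    case (Suc l)
    show ?thesis
    proof (cases "k \<le> n")
      case False
      hence "k = Suc n" using Suc.prems by simp
      thus ?thesis by (simp add: gauss_binomial_eq_0 del: gauss_binomial.simps)
    next
      case True
      hence l: "l \<le> n" and pow: "q ^ Suc n = q ^ Suc l * q ^ (n - l)"
        using Suc True by (auto simp flip: power_add power_Suc)
      have "(1 - q ^ (Suc n - k)) * gauss_binomial q (Suc n) k =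
          (1 - q ^ (n - l)) * gauss_binomial q n l +
          q ^ Suc l * ((1 - q ^ (n - l)) * gauss_binomial q n (Suc l))"
        unfolding Suc by (simp add: algebra_simps)
      also have "\<dots> = (1 - q ^ Suc n) * gauss_binomial q n (Suc l)"
        unfolding Suc.IH[OF l, symmetric] pow
        by (simp only: left_diff_distrib right_diff_distrib mult_1_left mult.assoc) simp
      also have "\<dots> = (1 - q ^ Suc k) * gauss_binomial q (Suc n) (Suc k)"
        using gauss_binomial_absorb_aux[OF Suc.IH[OF True] True] by (simp only: Suc)
      finally show ?thesis ..
    qed
  qed
qed

lemma gauss_binomial_absorb:
  "k \<le> n \<Longrightarrow>
     (1 - q ^ Suc k) * gauss_binomial q (Suc n) (Suc k) = (1 - q ^ Suc n) * gauss_binomial q n k"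
  by (rule gauss_binomial_absorb_aux[OF gauss_binomial_Suc_right])

lemma gauss_binomial_Pascal':
  assumes "k \<le> n"
  shows "gauss_binomial q (Suc n) (Suc k) =
           q ^ (n - k) * gauss_binomial q n k + gauss_binomial q n (Suc k)"
  using gauss_binomial_Suc_right[OF assms, of q] by (simp add: algebra_simps)

lemma gauss_binomial_self: "gauss_binomial q n n = 1"
  by (induction n) (simp_all add: gauss_binomial_eq_0)

lemma gauss_binomial_symmetric:
  "gauss_binomial q (a + b) a = gauss_binomial q (a + b) b"
proof (induction "a + b" arbitrary: a b)
  case 0
  thus ?case by simp
next
  case (Suc n)
  consider "a = 0" | "b = 0" | a' b' where "a = Suc a'" "b = Suc b'"
    by (metis not0_implies_Suc)
  thus ?case
  proof cases
    case 3
    have n: "n = a' + b" "n = a + b'"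
      using Suc(2) 3 by simp_all
    have "gauss_binomial q (a + b) a = gauss_binomial q n a' + q ^ a * gauss_binomial q n a"
      using Suc(2) 3 by (simp flip: Suc(2))
    also have "gauss_binomial q n a' = gauss_binomial q n b"
      using Suc(1)[OF n(1)] n(1) by simp
    also have "gauss_binomial q n a = gauss_binomial q n b'"
      using Suc(1)[OF n(2)] n(2) by simp
    also have "gauss_binomial q n b + q ^ a * gauss_binomial q n b' = gauss_binomial q (a + b) b"
      using gauss_binomial_Pascal'[of b' n q] Suc(2) n 3 by (simp flip: Suc(2))
    finally show ?thesis .
  qed (simp_all add: gauss_binomial_self)
qed

lemma gauss_binomial_qpoch:
  "gauss_binomial q (a + b) a * qpoch q q a * qpoch q q b = qpoch q q (a + b)"
proof (induction a)
  case 0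
  thus ?case by (simp add: qpoch_def)
next
  case (Suc a)
  have "gauss_binomial q (Suc a + b) (Suc a) * qpoch q q (Suc a) * qpoch q q b =
      ((1 - q ^ Suc a) * gauss_binomial q (Suc (a + b)) (Suc a)) * qpoch q q a * qpoch q q b"
    by (simp add: qpoch_def mult_ac del: gauss_binomial.simps)
  also have "\<dots> = (1 - q ^ Suc (a + b)) * (gauss_binomial q (a + b) a * qpoch q q a * qpoch q q b)"
    by (subst gauss_binomial_absorb) (simp_all add: mult_ac)
  also have "\<dots> = qpoch q q (Suc a + b)"
    unfolding Suc.IH by (simp add: qpoch_def mult_ac)
  finally show ?case .
qed

text \<open>
  The homogeneous form has only natural exponents; the triple product below needs the substitution
  \<open>y/x = - q\<^bsup>1-2m\<^esup>\<close>, which this form expresses without negative powers.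
\<close>

theorem q_binomial_theorem:
  fixes x y q :: "'a::comm_ring_1"
  shows "(\<Prod>i<n. x + y * q ^ i) =
           (\<Sum>k\<le>n. q ^ (k choose 2) * gauss_binomial q n k * y ^ k * x ^ (n - k))"
proof (induction n arbitrary: y)
  case 0
  show ?case by (simp add: binomial_eq_0)
next
  case (Suc n)
  define t where "t k = q ^ (Suc k choose 2) * gauss_binomial q n k * y ^ k" for k
  have choose: "Suc k choose 2 = (k choose 2) + k" for k
    by (simp add: numeral_2_eq_2)
  have "(\<Prod>i<Suc n. x + y * q ^ i) = (x + y) * (\<Prod>i<n. x + (y * q) * q ^ i)"
    by (simp add: prod.lessThan_Suc_shift mult.assoc del: prod.lessThan_Suc)
  also have "\<dots> = (x + y) * (\<Sum>k\<le>n. t k * x ^ (n - k))"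
    unfolding Suc.IH by (simp add: t_def choose power_add power_mult_distrib mult_ac)
  also have "\<dots> = (\<Sum>k\<le>n. t k * x ^ (Suc n - k)) + (\<Sum>k\<le>n. t k * y * x ^ (n - k))"
    unfolding sum_distrib_left sum.distrib[symmetric]
    by (intro sum.cong refl) (simp add: Suc_diff_le algebra_simps)
  also have "(\<Sum>k\<le>n. t k * x ^ (Suc n - k)) = (\<Sum>k\<le>Suc n. t k * x ^ (Suc n - k))"
    by (simp add: t_def gauss_binomial_eq_0)
  also have "\<dots> = x ^ Suc n + (\<Sum>k\<le>n. t (Suc k) * x ^ (n - k))"
    by (subst sum.atMost_Suc_shift) (simp add: t_def numeral_2_eq_2)
  also have "\<dots> + (\<Sum>k\<le>n. t k * y * x ^ (n - k)) =
      x ^ Suc n + (\<Sum>k\<le>n. (t (Suc k) + t k * y) * x ^ (n - k))"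
    by (simp add: distrib_right sum.distrib)
  also have "(\<lambda>k. t (Suc k) + t k * y) =
      (\<lambda>k. q ^ (Suc k choose 2) * gauss_binomial q (Suc n) (Suc k) * y ^ Suc k)"
    by (simp add: fun_eq_iff t_def choose[of "Suc k" for k] power_add algebra_simps)
  finally show ?case
    by (subst sum.atMost_Suc_shift) (simp del: gauss_binomial.simps(3) add: binomial_eq_0)
qed

section \<open>A finite Jacobi triple product\<close>

lemma sum_fold_around_middle:
  fixes g :: "nat \<Rightarrow> 'a::comm_monoid_add"
  assumes "i \<le> m"
  shows "(\<Sum>k=m-i..m+i. g k) = (\<Sum>j\<le>i. if j = 0 then g m else g (m + j) + g (m - j))"
  using assms
proof (induction i)
  case (Suc i)
  have "{m - Suc i..m + Suc i} = insert (m - Suc i) (insert (m + Suc i) {m - i..m + i})"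
    using Suc.prems by auto
  moreover have "m - Suc i \<notin> {m - i..m + i}" "m + Suc i \<notin> {m - i..m + i}" "m - Suc i \<noteq> m + Suc i"
    using Suc.prems by auto
  ultimately show ?case
    using Suc by (simp add: add_ac)
qed simp

lemma prod_odd_powers: "(\<Prod>i<m. q * (q ^ 2) ^ i) = (q :: 'a::comm_ring_1) ^ (m ^ 2)"
proof (induction m)
  case (Suc m)
  have "(Suc m) ^ 2 = m ^ 2 + (1 + 2 * m)"
    by (simp add: power2_eq_square)
  thus ?case
    using Suc by (simp only: prod.lessThan_Suc power_add power_mult power_one_right)
qed simp

text \<open>
  The upper half of the factors is \<open>q\<^bsup>2m\<^esup> (1 - q\<^bsup>2i+1\<^esup>)\<close>, and the lower half, read backwards, is
  \<open>- q\<^bsup>2i+1\<^esup> (1 - q\<^bsup>2(m-1-i)+1\<^esup>)\<close>; both contain a full copy of \<open>(q;q\<^sup>2)\<^sub>m\<close>.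
\<close>

lemma prod_central_factors:
  fixes q :: "'a::comm_ring_1"
  shows "(\<Prod>i<2 * m. q ^ (2 * m) + (- q) * (q ^ 2) ^ i) =
    (-1) ^ m * q ^ (m ^ 2) * qpoch q (q ^ 2) m * (q ^ (2 * m ^ 2) * qpoch q (q ^ 2) m)"
proof -
  define h where "h i = q ^ (2 * m) + (- q) * (q ^ 2) ^ i" for i
  have factor: "a + (- q) * (a * b) = a * (1 - q * b)" for a b
    by (simp add: algebra_simps)
  have "{..<2 * m} = {..<m} \<union> {m..<2 * m}"
    by auto
  hence "prod h {..<2 * m} = prod h {..<m} * prod h {m..<2 * m}"
    by (simp add: prod.union_disjoint ivl_disj_int)
  also have "prod h {m..<2 * m} = (\<Prod>i<m. h (m + i))"
    using prod.shift_bounds_nat_ivl[of h 0 m m] by (simp add: mult_2 add.commute lessThan_atLeast0)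
  also have "\<dots> = (\<Prod>i<m. q ^ (2 * m) * (1 - q * (q ^ 2) ^ i))"
    unfolding h_def power_mult power_add by (simp only: factor)
  also have "\<dots> = q ^ (2 * m ^ 2) * qpoch q (q ^ 2) m"
    by (simp add: prod.distrib qpoch_def power2_eq_square[of m] mult.assoc flip: power_mult)
  also have "prod h {..<m} = (\<Prod>i<m. (-1) * (q * (q ^ 2) ^ i) * (1 - q * (q ^ 2) ^ (m - Suc i)))"
  proof (intro prod.cong refl)
    fix i assume "i \<in> {..<m}"
    then obtain d where d: "m = Suc (i + d)"
      using less_imp_Suc_add by blast
    have "q ^ (2 * m) = (q * (q ^ 2) ^ i) * (q * (q ^ 2) ^ (m - Suc i))"
      unfolding d power_mult by (simp add: power_add power2_eq_square[of q])
    thus "h i = (-1) * (q * (q ^ 2) ^ i) * (1 - q * (q ^ 2) ^ (m - Suc i))"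
      unfolding h_def by (simp add: right_diff_distrib)
  qed
  also have "\<dots> = (-1) ^ m * (\<Prod>i<m. q * (q ^ 2) ^ i) * (\<Prod>i<m. 1 - q * (q ^ 2) ^ (m - Suc i))"
    by (simp only: prod.distrib prod_constant card_lessThan)
  also have "\<dots> = (-1) ^ m * q ^ (m ^ 2) * qpoch q (q ^ 2) m"
    unfolding prod_odd_powers prod.nat_diff_reindex[of "\<lambda>i. 1 - q * (q ^ 2) ^ i"] qpoch_def ..
  finally show ?thesis
    by (simp only: h_def)
qed

text \<open>
  This is the \<open>q\<close>-binomial theorem with base \<open>q\<^sup>2\<close> for the \<open>2m\<close> factors \<open>q\<^bsup>2m\<^esup> - q\<^bsup>2i+1\<^esup>\<close>,
  recentred at the middle coefficient. The terms for \<open>j\<close> and \<open>- j\<close> agree, whence the factor 2.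
\<close>

theorem finite_Jacobi_triple_product_at_1:
  fixes q :: "'a::idom"
  assumes "q \<noteq> 0"
  shows "(qpoch q (q ^ 2) m) ^ 2 =
    (\<Sum>j\<le>m. (if j = 0 then 1 else 2) * (-1) ^ j * q ^ (j ^ 2) * gauss_binomial (q ^ 2) (2 * m) (m + j))"
    (is "_ = (\<Sum>j\<le>m. ?t j)")
proof -
  define g where "g k = (q ^ 2) ^ (k choose 2) * gauss_binomial (q ^ 2) (2 * m) k * (- q) ^ k *
    (q ^ (2 * m)) ^ (2 * m - k)" for k
  define c where "c = (-1) ^ m * q ^ (3 * m ^ 2)"
  have c: "c \<noteq> 0"
    using assms by (simp add: c_def)
  have ch: "(q ^ 2) ^ (k choose 2) * q ^ k = q ^ (k ^ 2)" for k
  proof (cases k)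
    case (Suc l)
    have "2 * (k choose 2) + k = k ^ 2"
      unfolding choose_two Suc by (simp add: power2_eq_square)
    from this[symmetric] show ?thesis by (simp only: power_add power_mult)
  qed (simp add: binomial_eq_0)
  have g: "g k = (-1) ^ k * q ^ (k ^ 2 + 2 * m * (2 * m - k)) * gauss_binomial (q ^ 2) (2 * m) k" for k
  proof -
    have "g k = (-1) ^ k * ((q ^ 2) ^ (k choose 2) * q ^ k) * (q ^ (2 * m)) ^ (2 * m - k) *
        gauss_binomial (q ^ 2) (2 * m) k"
      unfolding g_def power_minus[of q k] by (simp only: mult_ac)
    thus ?thesis
      unfolding ch unfolding power_mult[symmetric] by (simp only: power_add mult_ac)
  qed
  \<comment> \<open>Completing the square: \<open>k = m \<plusminus> j\<close> makes the exponent \<open>k\<^sup>2 + 2m(2m - k)\<close> equal to \<open>3m\<^sup>2 + j\<^sup>2\<close>.\<close>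
  have plus: "g (m + j) = c * ((-1) ^ j * q ^ (j ^ 2) * gauss_binomial (q ^ 2) (2 * m) (m + j))"
    if j: "j \<le> m" for j
  proof -
    obtain d where d: "m = j + d" using le_Suc_ex[OF j] by blast
    have x: "2 * (j + d) - (j + d + j) = d"
      by arith
    have e: "(m + j) ^ 2 + 2 * m * (2 * m - (m + j)) = 3 * m ^ 2 + j ^ 2"
      unfolding d x by (simp add: power2_eq_square algebra_simps)
    show ?thesis
      unfolding g e c_def power_add by (simp only: mult_ac)
  qed
  have g0: "g m = c * gauss_binomial (q ^ 2) (2 * m) m"
    using plus[of 0] by simp
  have minus: "g (m - j) = c * ((-1) ^ j * q ^ (j ^ 2) * gauss_binomial (q ^ 2) (2 * m) (m + j))"
    if j: "j \<le> m" for j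
  proof -
    obtain d where d: "m = j + d" using le_Suc_ex[OF j] by blast
    have x: "j + d - j = d" "2 * (j + d) - d = 2 * j + d"
      by arith+
    have e: "(m - j) ^ 2 + 2 * m * (2 * m - (m - j)) = 3 * m ^ 2 + j ^ 2"
      unfolding d x by (simp add: power2_eq_square algebra_simps)
    have s: "(-1 :: 'a) ^ (m - j) = (-1) ^ m * (-1) ^ j"
      using d by (simp add: power_add minus_one_power_iff)
    have gb: "gauss_binomial (q ^ 2) (2 * m) (m - j) = gauss_binomial (q ^ 2) (2 * m) (m + j)"
      using gauss_binomial_symmetric[of "q ^ 2" "m - j" "m + j"] j by (simp add: mult_2)
    show ?thesis
      unfolding g e s gb c_def power_add by (simp only: mult_ac)
  qed
  have "(\<Prod>i<2 * m. q ^ (2 * m) + (- q) * (q ^ 2) ^ i) = (\<Sum>k\<le>2 * m. g k)"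
    unfolding g_def by (rule q_binomial_theorem)
  also have "\<dots> = (\<Sum>k=m-m..m+m. g k)"
    by (simp add: atMost_atLeast0 mult_2)
  also have "\<dots> = (\<Sum>j\<le>m. if j = 0 then g m else g (m + j) + g (m - j))"
    by (rule sum_fold_around_middle) simp
  also have "\<dots> = c * (\<Sum>j\<le>m. ?t j)"
    unfolding sum_distrib_left
    by (intro sum.cong refl) (simp add: plus minus g0)
  also have "(\<Prod>i<2 * m. q ^ (2 * m) + (- q) * (q ^ 2) ^ i) = c * (qpoch q (q ^ 2) m) ^ 2"
  proof -
    have "(\<Prod>i<2 * m. q ^ (2 * m) + (- q) * (q ^ 2) ^ i) =
        (-1) ^ m * q ^ (m ^ 2) * qpoch q (q ^ 2) m * (q ^ (2 * m ^ 2) * qpoch q (q ^ 2) m)"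
      by (simp only: prod_central_factors)
    moreover have "c = (-1) ^ m * q ^ (m ^ 2) * q ^ (2 * m ^ 2)"
      unfolding c_def by (simp flip: power_add)
    ultimately show ?thesis
      unfolding power2_eq_square[of "qpoch q (q ^ 2) m"] by (simp only: mult_ac)
  qed
  finally show ?thesis
    using c by simp
qed

section \<open>Limits of power series\<close>

lemma tendsto_mult_fps:
  fixes a b :: "'a::comm_ring_1 fps"
  assumes "(f \<longlongrightarrow> a) F" and "(g \<longlongrightarrow> b) F"
  shows "((\<lambda>x. f x * g x) \<longlongrightarrow> a * b) F"
proof (rule tendsto_fpsI)
  fix n
  have "eventually (\<lambda>x. \<forall>i\<in>{..n}. fps_nth (f x) i = fps_nth a i \<and> fps_nth (g x) i = fps_nth b i) F"
    using assms by (subst eventually_ball_finite_distrib) (auto simp: tendsto_fps_iff eventually_conj_iff)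
  thus "eventually (\<lambda>x. fps_nth (f x * g x) n = fps_nth (a * b) n) F"
    by eventually_elim (simp add: fps_mult_nth)
qed

lemma tendsto_qpoch_fps:
  fixes a q :: "'a::idom fps"
  assumes "fps_nth a 0 = 0" and "fps_nth q 0 = 0"
  shows "qpoch a q \<longlonglongrightarrow> qpoch_inf a q"
  using has_prod_imp_tendsto'[OF qpoch_inf_fps_has_prod[OF assms]] by (simp only: qpoch_def[abs_def])

lemma qpoch_inf_fps_nth_0:
  fixes a q :: "'a::idom fps"
  assumes "fps_nth a 0 = 0" and "fps_nth q 0 = 0"
  shows "fps_nth (qpoch_inf a q) 0 = 1"
proof -
  have "eventually (\<lambda>n. fps_nth (qpoch a q n) 0 = fps_nth (qpoch_inf a q) 0) sequentially"
    using tendsto_qpoch_fps[OF assms] by (simp add: tendsto_fps_iff)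
  thus ?thesis
    using assms(1) by (simp add: qpoch_fps_nth_0)
qed

lemma qpoch_inf_square:
  fixes q :: "'a::idom fps"
  assumes "fps_nth q 0 = 0"
  shows "qpoch_inf (q ^ 2) (q ^ 2) = qpoch_inf q q * qpoch_inf (- q) q"
proof (rule LIMSEQ_unique)
  show "qpoch (q ^ 2) (q ^ 2) \<longlonglongrightarrow> qpoch_inf (q ^ 2) (q ^ 2)"
    using assms by (intro tendsto_qpoch_fps) (simp_all add: power2_eq_square)
  have "qpoch (q ^ 2) (q ^ 2) n = qpoch q q n * qpoch (- q) q n" for n
  proof -
    have "1 - q ^ 2 * (q ^ 2) ^ j = (1 - q * q ^ j) * (1 - - q * q ^ j)" for j
      by (simp add: algebra_simps power2_eq_square power_mult_distrib)
    thus ?thesis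
      by (simp add: qpoch_def prod.distrib)
  qed
  moreover have "(\<lambda>n. qpoch q q n * qpoch (- q) q n) \<longlonglongrightarrow> qpoch_inf q q * qpoch_inf (- q) q"
    using assms by (intro tendsto_mult_fps tendsto_qpoch_fps) simp_all
  ultimately show "qpoch (q ^ 2) (q ^ 2) \<longlonglongrightarrow> qpoch_inf q q * qpoch_inf (- q) q"
    by presburger
qed

text \<open>
  A Gaussian binomial coefficient whose two lower indices both grow tends to \<open>1 / (q;q)\<^sub>\<infinity>\<close>, and
  \<open>(q;q)\<^sub>\<infinity> (-q;q)\<^sub>\<infinity> = (q\<^sup>2;q\<^sup>2)\<^sub>\<infinity>\<close>. This is where the prefactor of \<open>P\<close> is used up.
\<close>

lemma tendsto_central_gauss_binomial:
  fixes q :: "'a::field fps"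
  assumes q: "fps_nth q 0 = 0"
  shows "(\<lambda>M. qpoch_inf (q ^ 2) (q ^ 2) * gauss_binomial q (2 * M) (M + j) * inverse (qpoch (- q) q M))
           \<longlonglongrightarrow> 1"
proof -
  define E where "E = qpoch_inf q q"
  define D where "D = qpoch_inf (- q) q"
  have E: "fps_nth E 0 \<noteq> 0" and D: "fps_nth D 0 \<noteq> 0"
    using q by (simp_all add: E_def D_def qpoch_inf_fps_nth_0)
  have lim: "qpoch q q \<longlonglongrightarrow> E"
    unfolding E_def using q by (intro tendsto_qpoch_fps)
  have "strict_mono (\<lambda>M :: nat. 2 * M)"
    by (simp add: strict_mono_def)
  hence lim2: "(\<lambda>M. qpoch q q (2 * M)) \<longlonglongrightarrow> E"
    by (intro filterlim_compose[OF lim] filterlim_subseq)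
  have lim_plus: "(\<lambda>M. qpoch q q (M + j)) \<longlonglongrightarrow> E"
    by (intro filterlim_compose[OF lim] filterlim_add_const_nat_at_top)
  have lim_minus: "(\<lambda>M. qpoch q q (M - j)) \<longlonglongrightarrow> E"
    by (intro filterlim_compose[OF lim] filterlim_minus_const_nat_at_top)
  have lim_D: "qpoch (- q) q \<longlonglongrightarrow> D"
    unfolding D_def using q by (intro tendsto_qpoch_fps) simp_all
  have "(\<lambda>M. (E * D) * (qpoch q q (2 * M) * inverse (qpoch q q (M + j)) * inverse (qpoch q q (M - j))) *
          inverse (qpoch (- q) q M)) \<longlonglongrightarrow> (E * D) * (E * inverse E * inverse E) * inverse D"
    by (intro tendsto_mult_fps tendsto_const tendsto_inverse_fps lim2 lim_plus lim_minus lim_D E D)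
  also have "(E * D) * (E * inverse E * inverse E) * inverse D =
      (E * inverse E) * (E * inverse E) * (D * inverse D)"
    by (simp only: mult_ac)
  also have "\<dots> = 1"
    using E D by (simp add: inverse_mult_eq_1')
  finally show ?thesis
  proof (rule Lim_transform_eventually)
    show "eventually (\<lambda>M. (E * D) * (qpoch q q (2 * M) * inverse (qpoch q q (M + j)) *
        inverse (qpoch q q (M - j))) * inverse (qpoch (- q) q M) =
        qpoch_inf (q ^ 2) (q ^ 2) * gauss_binomial q (2 * M) (M + j) * inverse (qpoch (- q) q M)) sequentially"
      using eventually_ge_at_top[of j]
    proof eventually_elim
      case (elim M)
      have unit: "qpoch q q n * inverse (qpoch q q n) = 1" for n
        using q by (simp add: inverse_mult_eq_1' qpoch_fps_nth_0)
      have fac: "qpoch q q (2 * M) = gauss_binomial q (2 * M) (M + j) * qpoch q q (M + j) * qpoch q q (M - j)"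
        using gauss_binomial_qpoch[of q "M + j" "M - j"] elim by (simp add: mult_2)
      have "qpoch q q (2 * M) * inverse (qpoch q q (M + j)) * inverse (qpoch q q (M - j)) =
          gauss_binomial q (2 * M) (M + j) * (qpoch q q (M + j) * inverse (qpoch q q (M + j))) *
          (qpoch q q (M - j) * inverse (qpoch q q (M - j)))"
        unfolding fac by (simp only: mult_ac)
      also have "\<dots> = gauss_binomial q (2 * M) (M + j)"
        by (simp only: unit mult_1_right)
      finally show ?case
        by (simp only: qpoch_inf_square[OF q] E_def D_def)
    qed
  qed
qed

section \<open>The telescoping recurrence\<close>

text \<open>
  In the language of Bailey pairs this is the truncation at \<open>M\<close> of the sequence \<open>\<gamma>\<^sub>j\<close> conjugate to
  \<open>\<delta>\<^sub>m = q\<^sup>m (q;q)\<^bsub>2m\<^esub> / (-q;q)\<^sub>m\<close>.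
\<close>

definition conjugate_sum :: "'a::field fps \<Rightarrow> nat \<Rightarrow> nat \<Rightarrow> 'a fps" where
  "conjugate_sum q M j = (\<Sum>m<M. q ^ m * gauss_binomial q (2 * m) (m + j) * inverse (qpoch (- q) q m))"

text \<open>
  Divided by \<open>(-q;q)\<^bsub>m+1\<^esub>\<close>, this says that the summand of \<open>F\<^sub>j + q\<^bsup>3j+3\<^esup> F\<^bsub>j+2\<^esub>\<close> is the difference
  \<open>G(m+1) - G(m)\<close> for
  \[ G(m) = q^j (1 + q^{j+1}) \frac{[2m, m+j+1]}{(-q;q)_m}, \]
  a certificate of the Wilf-Zeilberger kind. All four Gaussian binomials are rational functions
  of \<open>q\<^sup>m\<close>, \<open>q\<^sup>j\<close> and \<open>q\<close> times \<open>[2m, m+j]\<close>; once their common denominator is cleared, a polynomial identity in \<open>q\<close>,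
  \<open>a = q\<^sup>j\<close> and \<open>v = q\<^bsup>m-j\<^esup>\<close> remains.
\<close>

lemma telescoping_certificate:
  fixes q :: "'a::idom"
  assumes nz: "\<And>n. q ^ Suc n \<noteq> 1"
  shows "q ^ m * (gauss_binomial q (2 * m) (m + j) +
            q ^ (3 * j + 3) * gauss_binomial q (2 * m) (m + (j + 2))) * (1 + q ^ Suc m) =
         q ^ j * (1 + q ^ Suc j) * (gauss_binomial q (2 * Suc m) (Suc m + Suc j) -
            gauss_binomial q (2 * m) (m + Suc j) * (1 + q ^ Suc m))"
proof (cases "j \<le> m")
  case False
  thus ?thesis
    by (simp add: gauss_binomial_eq_0 del: gauss_binomial.simps)
next
  case True
  then obtain d where m: "m = j + d"
    using le_Suc_ex by blast
  define a v where "a = q ^ j" and "v = q ^ d"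
  define B0 B1 B2 B' where "B0 = gauss_binomial q (2 * m) (m + j)"
    and "B1 = gauss_binomial q (2 * m) (m + Suc j)"
    and "B2 = gauss_binomial q (2 * m) (m + (j + 2))"
    and "B' = gauss_binomial q (2 * Suc m) (Suc m + Suc j)"
  define u where "u = a * v"
  have u: "q ^ m = u"
    by (simp add: u_def a_def v_def m power_add)
  have D1: "q ^ Suc (m + j) = u * a * q" and D2: "q ^ Suc (Suc (m + j)) = u * a * q ^ 2"
    by (simp_all add: power_add u a_def power2_eq_square mult_ac)
  have u2: "q ^ (2 * m) = u * u"
    unfolding mult_2 power_add u ..
  have D3: "q ^ Suc (2 * m) = u ^ 2 * q" and D4: "q ^ Suc (Suc (2 * m)) = u ^ 2 * q ^ 2"
    unfolding power_Suc u2 power2_eq_square by (simp_all only: mult_ac)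
  have B1: "(1 - u * a * q) * B1 = (1 - v) * B0"
    using gauss_binomial_Suc_right[of "m + j" "2 * m" q] unfolding D1
    by (simp add: B0_def B1_def v_def m)
  \<comment> \<open>The factor \<open>q\<close> stands for the missing \<open>q\<^bsup>d-1\<^esup>\<close>, so that the rule also covers \<open>d = 0\<close>.\<close>
  have B2: "(1 - u * a * q ^ 2) * (q * B2) = (q - v) * B1"
  proof (cases d)
    case 0
    thus ?thesis
      by (simp add: B1_def B2_def m gauss_binomial_eq_0)
  next
    case (Suc e)
    have "(1 - u * a * q ^ 2) * B2 = (1 - q ^ e) * B1"
      using gauss_binomial_Suc_right[of "Suc (m + j)" "2 * m" q] unfolding D2
      by (simp add: B2_def B1_def m Suc)
    hence "(1 - u * a * q ^ 2) * (q * B2) = q * ((1 - q ^ e) * B1)"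
      by (simp only: mult.left_commute)
    thus ?thesis
      by (simp add: v_def Suc left_diff_distrib right_diff_distrib mult.assoc)
  qed
  define C where "C = gauss_binomial q (Suc (2 * m)) (Suc (m + j))"
  have C: "(1 - u * a * q) * C = (1 - u ^ 2 * q) * B0"
    using gauss_binomial_absorb[of "m + j" "2 * m" q] True unfolding D1 D3
    by (simp add: C_def B0_def del: gauss_binomial.simps)
  have B': "(1 - u * a * q ^ 2) * B' = (1 - u ^ 2 * q ^ 2) * C"
    using gauss_binomial_absorb[of "Suc (m + j)" "Suc (2 * m)" q] True unfolding D2 D4
    by (simp add: C_def B'_def del: gauss_binomial.simps)
  define K where "K = (1 - u * a * q) * (1 - u * a * q ^ 2)"
  have "K \<noteq> 0"
    using nz[of "m + j"] nz[of "Suc (m + j)"] unfolding K_def D1 D2 by simp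
  have KB0: "K * B0 = (1 - u * a * q) * (1 - u * a * q ^ 2) * B0"
    by (simp add: K_def)
  have KB1: "K * B1 = (1 - u * a * q ^ 2) * (1 - v) * B0"
  proof -
    have "K * B1 = (1 - u * a * q ^ 2) * ((1 - u * a * q) * B1)"
      by (simp only: K_def mult_ac)
    thus ?thesis
      unfolding B1 by (simp only: mult_ac)
  qed
  have KB2: "K * (q * B2) = (q - v) * (1 - v) * B0"
  proof -
    have "K * (q * B2) = (1 - u * a * q) * ((1 - u * a * q ^ 2) * (q * B2))"
      by (simp only: K_def mult_ac)
    also have "\<dots> = (q - v) * ((1 - u * a * q) * B1)"
      unfolding B2 by (simp only: mult_ac)
    finally show ?thesis
      unfolding B1 by (simp only: mult_ac)
  qed
  have KB': "K * B' = (1 - u ^ 2 * q ^ 2) * (1 - u ^ 2 * q) * B0"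
  proof -
    have "K * B' = (1 - u * a * q) * ((1 - u * a * q ^ 2) * B')"
      by (simp only: K_def mult_ac)
    also have "\<dots> = (1 - u ^ 2 * q ^ 2) * ((1 - u * a * q) * C)"
      unfolding B' by (simp only: mult_ac)
    finally show ?thesis
      unfolding C by (simp only: mult_ac)
  qed
  have "K * (u * (B0 + a ^ 3 * q ^ 3 * B2) * (1 + u * q)) =
      u * (K * B0 + a ^ 3 * q ^ 2 * (K * (q * B2))) * (1 + u * q)"
    by algebra
  also have "\<dots> = a * (1 + a * q) * (K * B' - K * B1 * (1 + u * q))"
    unfolding KB0 KB1 KB2 KB' u_def by algebra
  also have "\<dots> = K * (a * (1 + a * q) * (B' - B1 * (1 + u * q)))"
    by algebra
  finally have "u * (B0 + a ^ 3 * q ^ 3 * B2) * (1 + u * q) = a * (1 + a * q) * (B' - B1 * (1 + u * q))"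
    using \<open>K \<noteq> 0\<close> by simp
  note identity = this
  have powers: "q ^ (3 * j + 3) = a ^ 3 * q ^ 3" "q ^ Suc m = u * q" "q ^ Suc j = a * q" "q ^ j = a"
    by (simp_all add: a_def power_add power_mult u mult.commute flip: power_mult)
  show ?thesis
    unfolding B0_def[symmetric] B1_def[symmetric] B2_def[symmetric] B'_def[symmetric] powers u
    by (rule identity)
qed

lemma conjugate_sum_recurrence:
  fixes q :: "'a::field fps"
  assumes q: "fps_nth q 0 = 0"
  shows "conjugate_sum q M j + q ^ (3 * j + 3) * conjugate_sum q M (j + 2) =
           q ^ j * (1 + q ^ Suc j) * (gauss_binomial q (2 * M) (M + Suc j) * inverse (qpoch (- q) q M))"
proof (induction M)
  case 0
  show ?case by (simp add: conjugate_sum_def)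
next
  case (Suc m)
  define w where "w = inverse (qpoch (- q) q (Suc m))"
  have nz: "q ^ Suc n \<noteq> 1" for n
  proof
    assume "q ^ Suc n = 1"
    hence "fps_nth (q ^ Suc n) 0 = 1" by simp
    thus False using q by simp
  qed
  have w: "inverse (qpoch (- q) q m) = (1 + q ^ Suc m) * w"
  proof -
    have "fps_nth (1 + q ^ Suc m) 0 \<noteq> 0"
      using q by simp
    moreover have "qpoch (- q) q (Suc m) = qpoch (- q) q m * (1 + q ^ Suc m)"
      by (simp add: qpoch_def)
    ultimately show ?thesis
      by (simp add: w_def fps_inverse_mult inverse_mult_eq_1' mult_ac)
  qed
  let ?B = "gauss_binomial q (2 * m)"
  have "conjugate_sum q (Suc m) j + q ^ (3 * j + 3) * conjugate_sum q (Suc m) (j + 2) =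
      conjugate_sum q m j + q ^ (3 * j + 3) * conjugate_sum q m (j + 2) +
      q ^ m * (?B (m + j) + q ^ (3 * j + 3) * ?B (m + (j + 2))) * (1 + q ^ Suc m) * w"
    by (simp add: conjugate_sum_def w algebra_simps del: power_Suc)
  also have "\<dots> = q ^ j * (1 + q ^ Suc j) * (gauss_binomial q (2 * Suc m) (Suc m + Suc j) * w)"
    unfolding Suc.IH w telescoping_certificate[OF nz] by (simp add: algebra_simps del: power_Suc gauss_binomial.simps)
  finally show ?case
    by (simp only: w_def)
qed

section \<open>The exponents of \<open>P\<close>\<close>

text \<open>
  The truncation at \<open>M\<close> of \<open>H\<^sub>j\<close>, the contribution of \<open>j\<close> to \<open>P\<close> up to sign. In the limit the
  recurrence unfolds to
  \[ H_j = \sum_{k \ge 0} (-1)^k q^{j^2 + 2j + 6k^2 + 6jk + 4k} (1 + q^{2j+4k+2}), \]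
  so that summation over \<open>j\<close> gives an indefinite theta series.
\<close>

definition theta_part :: "nat \<Rightarrow> nat \<Rightarrow> rat fps" where
  "theta_part M j =
     fps_X ^ (j ^ 2) * (qpoch_inf (fps_X ^ 4) (fps_X ^ 4) * conjugate_sum (fps_X ^ 2) M j)"

text \<open>
  The recurrence of \<open>conjugate_sum\<close> at \<open>q\<^sup>2\<close>. The exponent of the last term comes out as \<open>2j + 2\<close>
  because \<open>j\<^sup>2 + 2(3j + 3) = (j + 2)\<^sup>2 + 2j + 2\<close>.
\<close>

lemma theta_part_recurrence:
  "\<exists>W. W \<longlonglongrightarrow> (1 :: rat fps) \<and>
     (\<forall>M. theta_part M j = fps_X ^ (j ^ 2 + 2 * j) * (1 + fps_X ^ (2 * j + 2)) * W M
            - fps_X ^ (2 * j + 2) * theta_part M (j + 2))"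
proof -
  define p where "p = (fps_X :: rat fps) ^ 2"
  define Q where "Q = qpoch_inf ((fps_X :: rat fps) ^ 4) (fps_X ^ 4)"
  define W where "W M = Q * gauss_binomial p (2 * M) (M + Suc j) * inverse (qpoch (- p) p M)" for M
  have p: "fps_nth p 0 = 0"
    by (simp add: p_def)
  have pk: "p ^ k = fps_X ^ (2 * k)" for k
    by (simp add: p_def flip: power_mult)
  have Q: "Q = qpoch_inf (p ^ 2) (p ^ 2)"
    by (simp add: Q_def pk)
  have "W \<longlonglongrightarrow> 1"
    using tendsto_central_gauss_binomial[OF p, of "Suc j"] unfolding W_def Q by simp
  moreover have "theta_part M j = fps_X ^ (j ^ 2 + 2 * j) * (1 + fps_X ^ (2 * j + 2)) * W M
            - fps_X ^ (2 * j + 2) * theta_part M (j + 2)" for M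
  proof -
    have e: "2 * j + 2 + (j + 2) ^ 2 = j ^ 2 + 2 * (3 * j + 3)"
      by (simp add: power2_eq_square)
    have "fps_X ^ (2 * j + 2) * theta_part M (j + 2) =
        fps_X ^ (2 * j + 2 + (j + 2) ^ 2) * Q * conjugate_sum p M (j + 2)"
      by (simp only: theta_part_def power_add Q_def p_def mult_ac)
    also have "\<dots> = fps_X ^ (j ^ 2) * Q * (p ^ (3 * j + 3) * conjugate_sum p M (j + 2))"
      unfolding e pk power_add[of _ "j ^ 2"] by (simp only: mult_ac)
    finally have "theta_part M j + fps_X ^ (2 * j + 2) * theta_part M (j + 2) =
        fps_X ^ (j ^ 2) * Q * (conjugate_sum p M j + p ^ (3 * j + 3) * conjugate_sum p M (j + 2))"
      by (simp only: theta_part_def Q_def p_def distrib_left mult.assoc)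
    also have "\<dots> = fps_X ^ (j ^ 2 + 2 * j) * (1 + fps_X ^ (2 * Suc j)) * W M"
      unfolding conjugate_sum_recurrence[OF p] unfolding W_def power_add[of _ "j ^ 2"] pk
      by (simp only: mult_ac)
    finally show ?thesis
      by (simp add: algebra_simps)
  qed
  ultimately show ?thesis
    by blast
qed

text \<open>
  The quantity \<open>6n + 4 + 3j\<^sup>2\<close> is invariant under \<open>(n, j) \<mapsto> (n - 2j - 2, j + 2)\<close>, the step of the
  recurrence, so only the two initial exponents have to be inspected.
\<close>

lemma theta_part_support:
  "eventually (\<lambda>M. fps_nth (theta_part M j) n \<noteq> 0 \<longrightarrow> (\<exists>x. 6 * n + 4 + 3 * j ^ 2 = x ^ 2)) sequentially"
proof (induction n arbitrary: j rule: less_induct)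
  case (less n)
  define L where "L = (fps_X :: rat fps) ^ (j ^ 2 + 2 * j) * (1 + fps_X ^ (2 * j + 2))"
  obtain W where W: "W \<longlonglongrightarrow> (1 :: rat fps)"
    and rec: "\<And>M. theta_part M j = L * W M - fps_X ^ (2 * j + 2) * theta_part M (j + 2)"
    using theta_part_recurrence[of j] unfolding L_def by blast
  have "(\<lambda>M. L * W M) \<longlonglongrightarrow> L * 1"
    by (intro tendsto_mult_fps tendsto_const W)
  hence lim: "eventually (\<lambda>M. fps_nth (L * W M) n = fps_nth L n) sequentially"
    by (simp add: tendsto_fps_iff)
  have L_support: "\<exists>x. 6 * n + 4 + 3 * j ^ 2 = x ^ 2" if L: "fps_nth L n \<noteq> 0"
  proof -
    have "L = fps_X ^ (j ^ 2 + 2 * j) + fps_X ^ (j ^ 2 + 2 * j + (2 * j + 2))"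
      by (simp only: L_def distrib_left mult_1_right power_add[symmetric])
    hence "n = j ^ 2 + 2 * j \<or> n = j ^ 2 + 2 * j + (2 * j + 2)"
      using L by (auto split: if_splits)
    thus ?thesis
    proof
      assume "n = j ^ 2 + 2 * j"
      hence "6 * n + 4 + 3 * j ^ 2 = (3 * j + 2) ^ 2"
        by (simp add: power2_eq_square algebra_simps)
      thus ?thesis ..
    next
      assume "n = j ^ 2 + 2 * j + (2 * j + 2)"
      hence "6 * n + 4 + 3 * j ^ 2 = (3 * j + 4) ^ 2"
        by (simp add: power2_eq_square algebra_simps)
      thus ?thesis ..
    qed
  qed
  have step: "eventually (\<lambda>M. fps_nth (fps_X ^ (2 * j + 2) * theta_part M (j + 2)) n \<noteq> 0 \<longrightarrow>
      (\<exists>x. 6 * n + 4 + 3 * j ^ 2 = x ^ 2)) sequentially"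
  proof (cases "n < 2 * j + 2")
    case True
    thus ?thesis
      by (simp only: fps_X_power_mult_nth) simp
  next
    case False
    then obtain k where n: "n = 2 * j + 2 + k"
      using le_Suc_ex by (metis linorder_not_less)
    have e: "6 * n + 4 + 3 * j ^ 2 = 6 * k + 4 + 3 * (j + 2) ^ 2"
      by (simp add: n power2_eq_square algebra_simps)
    have "fps_nth (fps_X ^ (2 * j + 2) * theta_part M (j + 2)) n = fps_nth (theta_part M (j + 2)) k" for M
      by (simp only: fps_X_power_mult_nth n) simp
    moreover have "k < n"
      using n by simp
    ultimately show ?thesis
      unfolding e using less.IH[of k "j + 2"] by (simp only:)
  qed
  from lim step show ?case
  proof eventually_elim
    case (elim M)
    show ?case
    proof
      assume "fps_nth (theta_part M j) n \<noteq> 0"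
      moreover have "fps_nth (theta_part M j) n =
          fps_nth L n - fps_nth (fps_X ^ (2 * j + 2) * theta_part M (j + 2)) n"
        using elim(1) by (simp only: rec[of M] fps_sub_nth)
      ultimately have "fps_nth L n \<noteq> 0 \<or> fps_nth (fps_X ^ (2 * j + 2) * theta_part M (j + 2)) n \<noteq> 0"
        by (metis diff_self)
      thus "\<exists>x. 6 * n + 4 + 3 * j ^ 2 = x ^ 2"
        using L_support elim(2) by blast
    qed
  qed
qed

text \<open>
  The inner sum over \<open>j \<le> m\<close> may run up to \<open>M\<close> because the Gaussian binomials vanish beyond \<open>m\<close>;
  this makes the two summations independent.
\<close>

lemma S_partial_sum:
  "qpoch_inf (fps_X ^ 4) (fps_X ^ 4) * (\<Sum>m<M. S_term m) =
     (\<Sum>j<M. (if j = 0 then 1 else 2) * (-1) ^ j * theta_part M j)"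
proof -
  define c :: "nat \<Rightarrow> rat fps" where "c j = (if j = 0 then 1 else 2) * (-1) ^ j" for j
  let ?p = "(fps_X :: rat fps) ^ 2"
  let ?B = "\<lambda>m j. ?p ^ m * gauss_binomial ?p (2 * m) (m + j) * inverse (qpoch (- ?p) ?p m)"
  have "S_term m = (\<Sum>j<M. c j * fps_X ^ (j ^ 2) * ?B m j)" if "m < M" for m
  proof -
    have "S_term m = (\<Sum>j\<le>m. c j * fps_X ^ (j ^ 2) * ?B m j)"
      unfolding S_term_eq finite_Jacobi_triple_product_at_1[OF fps_X_neq_zero] sum_distrib_right
      unfolding c_def power_mult[of fps_X 2 m] by (intro sum.cong refl) (simp only: mult_ac)
    also have "\<dots> = (\<Sum>j<M. c j * fps_X ^ (j ^ 2) * ?B m j)"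
      using that by (intro sum.mono_neutral_left) (auto simp: gauss_binomial_eq_0)
    finally show ?thesis .
  qed
  hence "(\<Sum>m<M. S_term m) = (\<Sum>m<M. \<Sum>j<M. c j * fps_X ^ (j ^ 2) * ?B m j)"
    by simp
  also have "\<dots> = (\<Sum>j<M. c j * fps_X ^ (j ^ 2) * conjugate_sum ?p M j)"
    by (subst sum.swap) (simp add: conjugate_sum_def sum_distrib_left)
  finally show ?thesis
    by (simp add: sum_distrib_left theta_part_def c_def mult_ac)
qed

text \<open>
  Since \<open>H\<^sub>j\<close> is divisible by \<open>q\<^bsup>j\<^sup>2\<^esup>\<close>, only the finitely many \<open>j \<le> n\<close> contribute to the
  coefficient of \<open>q\<^sup>n\<close>, so one \<open>M\<close> serves all of them.
\<close>

lemma P_series_support: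
  assumes "fps_nth P_series n \<noteq> 0"
  shows "\<exists>x j. 6 * n + 4 + 3 * j ^ 2 = x ^ 2"
proof -
  have "(\<lambda>M. qpoch_inf (fps_X ^ 4) (fps_X ^ 4) * (\<Sum>m<M. S_term m)) \<longlonglongrightarrow> P_series"
    unfolding P_series_def using S_term_sums
    by (intro tendsto_mult_fps tendsto_const) (simp add: sums_def)
  hence "eventually (\<lambda>M. fps_nth (qpoch_inf (fps_X ^ 4) (fps_X ^ 4) * (\<Sum>m<M. S_term m)) n
      = fps_nth P_series n) sequentially"
    by (simp add: tendsto_fps_iff)
  moreover have "eventually (\<lambda>M. \<forall>j\<in>{..n}. fps_nth (theta_part M j) n \<noteq> 0 \<longrightarrow>
      (\<exists>x. 6 * n + 4 + 3 * j ^ 2 = x ^ 2)) sequentially"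
    by (subst eventually_ball_finite_distrib) (simp, intro ballI theta_part_support)
  ultimately have "eventually (\<lambda>M. \<exists>x j. 6 * n + 4 + 3 * j ^ 2 = x ^ 2) sequentially"
  proof eventually_elim
    case (elim M)
    have "(\<Sum>j<M. fps_nth ((if j = 0 then 1 else 2) * (-1) ^ j * theta_part M j) n) \<noteq> 0"
      using elim(1) assms unfolding S_partial_sum fps_sum_nth by simp
    then obtain j where "j \<in> {..<M}" and "fps_nth ((if j = 0 then 1 else 2) * (-1) ^ j * theta_part M j) n \<noteq> 0"
      by (rule sum.not_neutral_contains_not_neutral)
    hence j: "fps_nth (theta_part M j) n \<noteq> 0"
      by (cases "even j") (auto simp: numeral_fps_const split: if_splits)
    have "j \<le> n"
    proof -
      have "j ^ 2 \<le> n"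
        using j by (auto simp: theta_part_def fps_X_power_mult_nth split: if_splits)
      thus ?thesis
        by (rule power2_nat_le_imp_le)
    qed
    thus ?case
      using elim(2) j by blast
  qed
  thus ?thesis
    by simp
qed

lemma square_mod_32:
  fixes x :: nat
  shows "x ^ 2 mod 32 \<in> {0, 1, 4, 9, 16, 17, 25}"
proof -
  have "\<forall>r\<in>{..<32 :: nat}. r ^ 2 mod 32 \<in> {0, 1, 4, 9, 16, 17, 25}"
    by (simp add: lessThan_nat_numeral)
  hence "(x mod 32) ^ 2 mod 32 \<in> {0, 1, 4, 9, 16, 17, 25}"
    by simp
  thus ?thesis
    by (simp add: power_mod)
qed

text \<open>
  The residue of \<open>n\<close> modulo 16 fixes \<open>6n + 4\<close> modulo 32, and there \<open>x\<^sup>2 - 3j\<^sup>2\<close> takes none of the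
  resulting values. Working modulo 16 would not suffice: \<open>n \<equiv> 6\<close> gives \<open>6n + 4 \<equiv> 8\<close>, and
  \<open>2\<^sup>2 - 3 \<cdot> 2\<^sup>2 = - 8\<close>.
\<close>

theorem theorem2:
  fixes n :: nat
  assumes "n mod 16 \<in> {1, 4, 5, 6, 9, 12, 13}"
  shows "fps_nth P_series n = 0"
proof (rule ccontr)
  assume "fps_nth P_series n \<noteq> 0"
  then obtain x j where xj: "6 * n + 4 + 3 * j ^ 2 = x ^ 2"
    using P_series_support by blast
  define r s where "r = n mod 16" and "s = j ^ 2 mod 32"
  have n: "n = 16 * (n div 16) + r" and j: "j ^ 2 = 32 * (j ^ 2 div 32) + s"
    by (simp_all add: r_def s_def)
  have "x ^ 2 = (6 * r + 4 + 3 * s) + 32 * (3 * (n div 16) + 3 * (j ^ 2 div 32))"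
    unfolding xj[symmetric] by (subst n, subst j) simp
  hence x: "x ^ 2 mod 32 = (6 * r + 4 + 3 * s) mod 32"
    by (simp only: mod_mult_self2)
  have "(6 * r + 4 + 3 * s) mod 32 \<notin> {0, 1, 4, 9, 16, 17, 25}"
    if "r \<in> {1, 4, 5, 6, 9, 12, 13}" "s \<in> {0, 1, 4, 9, 16, 17, 25}"
    using that by (elim insertE emptyE) simp_all
  thus False
    using assms square_mod_32[of j] square_mod_32[of x] x unfolding r_def s_def by metis
qed

end
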